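(* Let $a,b>0$ be real with $a\neq b$, let $r,k$ be nonnegative integers, and let $\bar\alpha_r=(\alpha_0,\dots,\alpha_{r-1})$ be a sequence of complex numbers with $\alpha_i\neq 1$ for all $i$. Then for all $x,y,z\in\mathbb{R}$ and all integers $n,m\ge 0$, $${}_{p}\mathbb{M}_{n+m}^{(r)}(z,y;k,a,b;\bar\alpha_{r})=\sum_{s=0}^{n}\sum_{q=0}^{m}\binom{n}{s}\binom{m}{q}(z-x)^{s+q}\,{}_{p}\mathbb{M}_{n+m-s-q}^{(r)}(x,y;k,a,b;\bar\alpha_{r}).$$
   Context: All generating functions are understood as formal power series in $t$ (with $b^t=e^{t\log b}$, $a^t=e^{t\log a}$), and $0^0=1$. Fix a family of functions $\varphi_n(y)$ and the series $\varphi(y,t)=\sum_{n\ge0}\varphi_n(y)\frac{t^n}{n!}$ with $\varphi_0(y)\neq0$. The 2-variable general polynomials $p_n(x,y)$ are defined by $e^{xt}\varphi(y,t)=\sum_{n\ge 0}p_n(x,y)\frac{t^n}{n!}$, with $p_0(x,y)=1$. The 2-variable unified family ${}_{p}\mathbb{M}_{n}^{(r)}(x,y;k,a,b;\bar\alpha_r)$ of generalized Apostol-Euler, Bernoulli and Genocchi polynomials of order $r$ is defined by $$\sum_{n=0}^{\infty}{}_{p}\mathbb{M}_{n}^{(r)}(x,y;k,a,b;\bar\alpha_{r})\frac{t^{n}}{n!}=\frac{(-1)^{r}t^{rk}2^{r(1-k)}}{\prod_{i=0}^{r-1}(\alpha_{i}b^{t}-a^{t})}\,e^{xt}\varphi(y,t).$$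 The left subscript $p$ is only a label referring to the family $p_n(x,y)$. *)

theory Defs
  imports Complex_Main "HOL-Computational_Algebra.Formal_Power_Series"
begin

(* b^t = e^(t log b) as a formal power series in t; meaningful for b > 0 *)
definition fps_real_base_exp :: "real \<Rightarrow> complex fps" where
  "fps_real_base_exp b = fps_exp (complex_of_real (ln b))"

definition phi_series :: "(nat \<Rightarrow> real \<Rightarrow> complex) \<Rightarrow> real \<Rightarrow> complex fps" where
  "phi_series \<phi> y = Abs_fps (\<lambda>n. \<phi> n y / fact n)"

definition general_poly_gf :: "(nat \<Rightarrow> real \<Rightarrow> complex) \<Rightarrow> real \<Rightarrow> real \<Rightarrow> complex fps" where
  "general_poly_gf \<phi> x y = fps_exp (complex_of_real x) * phi_series \<phi> y"

definition general_poly :: "(nat \<Rightarrow> real \<Rightarrow> complex) \<Rightarrow> nat \<Rightarrow> real \<Rightarrow> real \<Rightarrow> complex" where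
  "general_poly \<phi> n x y = fact n * fps_nth (general_poly_gf \<phi> x y) n"

(* Only \<alpha> 0, ..., \<alpha> (r - 1) matter. The exponent r (1 - k) may be negative, hence the
   integer power. The denominator is a unit of the power series ring exactly when
   \<alpha> i \<noteq> 1 for all i < r, because its constant term is the product of the \<alpha> i - 1. *)
definition unified_gf ::
  "(nat \<Rightarrow> real \<Rightarrow> complex) \<Rightarrow> nat \<Rightarrow> nat \<Rightarrow> real \<Rightarrow> real \<Rightarrow> (nat \<Rightarrow> complex)
    \<Rightarrow> real \<Rightarrow> real \<Rightarrow> complex fps" where
  "unified_gf \<phi> r k a b \<alpha> x y =
     (fps_const ((-1) ^ r * 2 powi (int r * (1 - int k))) * fps_X ^ (r * k))
       / (\<Prod>i<r. (fps_const (\<alpha> i) * fps_real_base_exp b - fps_real_base_exp a))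
       * general_poly_gf \<phi> x y"

definition unified_M ::
  "(nat \<Rightarrow> real \<Rightarrow> complex) \<Rightarrow> nat \<Rightarrow> nat \<Rightarrow> real \<Rightarrow> real \<Rightarrow> nat \<Rightarrow> real \<Rightarrow> real
    \<Rightarrow> (nat \<Rightarrow> complex) \<Rightarrow> complex" where
  "unified_M \<phi> r n x y k a b \<alpha> = fact n * fps_nth (unified_gf \<phi> r k a b \<alpha> x y) n"

lemma general_poly_generating_function:
  "Abs_fps (\<lambda>n. general_poly \<phi> n x y / fact n) = fps_exp (complex_of_real x) * phi_series \<phi> y"
  by (rule fps_ext) (simp add: general_poly_def general_poly_gf_def)

lemma unified_M_generating_function:
  "Abs_fps (\<lambda>n. unified_M \<phi> r n x y k a b \<alpha> / fact n) = unified_gf \<phi> r k a b \<alpha> x y"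
  by (rule fps_ext) (simp add: unified_M_def)

lemma unified_denominator_nth_0:
  fixes r :: nat
  shows "fps_nth (\<Prod>i<r. (fps_const (\<alpha> i) * fps_real_base_exp b - fps_real_base_exp a)) 0
     = (\<Prod>i<r. (\<alpha> i - 1))"
  by (induction r) (simp_all add: fps_real_base_exp_def)

end

theory Submission
  imports Defs
begin

text \<open>
  The argument \<open>x\<close> enters the generating function only through the factor \<open>e\<^sup>x\<^sup>t\<close>, so passing from
  \<open>x\<close> to \<open>z\<close> multiplies the series by \<open>e\<^sup>w\<^sup>t\<close> with \<open>w = z - x\<close>. The coefficients of this product are
  binomial convolutions, which is the addition formula \<open>unified_M_shift\<close> for a single index \<open>N\<close>:
  \<open>M\<^sub>N(z) = \<Sum>\<^sub>j (N choose j) w\<^sup>j M\<^sub>N\<^sub>-\<^sub>j(x)\<close>. For \<open>N = n + m\<close> its summand depends on \<open>j\<close> only, apart from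
  the binomial coefficient, and Vandermonde's identity distributes \<open>(n + m choose j)\<close> over the
  pairs \<open>(s, q)\<close> with \<open>s + q = j\<close> (\<open>sum_binomial_split\<close>). This is the double sum.
\<close>

text \<open>
  The binomial expansion of \<open>(1 + X)\<^sup>n (1 + X)\<^sup>m = (1 + X)\<^sup>n\<^sup>+\<^sup>m\<close>, with \<open>X\<^sup>j\<close> replaced by an arbitrary
  \<open>f j\<close>.
\<close>
lemma sum_binomial_split:
  fixes f :: "nat \<Rightarrow> 'a :: comm_semiring_1"
  shows "(\<Sum>j\<le>n + m. of_nat (n + m choose j) * f j) =
    (\<Sum>s\<le>n. \<Sum>q\<le>m. of_nat (n choose s) * of_nat (m choose q) * f (s + q))"
proof -
  let ?S = "{..n} \<times> {..m}"
  let ?c = "\<lambda>(s, q). (n choose s) * (m choose q)"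
  let ?fibre = "\<lambda>j. {p \<in> ?S. fst p + snd p = j}"
  have vandermonde_fibre: "sum ?c (?fibre j) = n + m choose j" for j
  proof -
    have "sum ?c (?fibre j) = sum ?c ((\<lambda>s. (s, j - s)) ` {..j})"
      \<comment> \<open>The extra points of the full antidiagonal have \<open>s > n\<close> or \<open>q > m\<close>, so a factor vanishes.\<close>
      by (rule sum.mono_neutral_left) (auto simp: image_iff)
    also have "\<dots> = (\<Sum>s\<le>j. (n choose s) * (m choose (j - s)))"
      by (subst sum.reindex) (auto simp: inj_on_def)
    finally show ?thesis
      by (simp add: vandermonde)
  qed
  have "(\<Sum>s\<le>n. \<Sum>q\<le>m. of_nat (n choose s) * of_nat (m choose q) * f (s + q)) =
      (\<Sum>p\<in>?S. of_nat (?c p) * f (fst p + snd p))"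
    by (simp add: sum.cartesian_product case_prod_unfold)
  also have "\<dots> = (\<Sum>j\<le>n + m. \<Sum>p\<in>?fibre j. of_nat (?c p) * f (fst p + snd p))"
    by (rule sum.group [symmetric]) auto
  also have "\<dots> = (\<Sum>j\<le>n + m. of_nat (sum ?c (?fibre j)) * f j)"
    by (simp add: sum_distrib_right)
  finally show ?thesis
    by (simp only: vandermonde_fibre)
qed

lemma unified_gf_shift:
  "unified_gf \<phi> r k a b \<alpha> z y = fps_exp (complex_of_real (z - x)) * unified_gf \<phi> r k a b \<alpha> x y"
proof -
  have "fps_exp (complex_of_real z) = fps_exp (complex_of_real (z - x)) * fps_exp (complex_of_real x)"
    by (simp flip: fps_exp_add_mult)
  then show ?thesis
    unfolding unified_gf_def general_poly_gf_def by (simp only: mult_ac)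
qed

lemma unified_M_shift:
  "unified_M \<phi> r N z y k a b \<alpha> =
    (\<Sum>j\<le>N. of_nat (N choose j) * (complex_of_real (z - x) ^ j * unified_M \<phi> r (N - j) x y k a b \<alpha>))"
  unfolding unified_M_def unified_gf_shift [of \<phi> r k a b \<alpha> z y x] fps_mult_nth sum_distrib_left
    atLeast0AtMost
  by (rule sum.cong) (simp_all add: binomial_fact)

theorem theorem3p3:
  fixes \<phi> :: "nat \<Rightarrow> real \<Rightarrow> complex"
    and a b :: real and r k :: nat and \<alpha> :: "nat \<Rightarrow> complex"
    and x y z :: real and n m :: nat
  assumes phi_0: "\<And>v. \<phi> 0 v \<noteq> 0"
    and p_0: "\<And>u v. general_poly \<phi> 0 u v = 1"
    and "a > 0" and "b > 0" and "a \<noteq> b"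
    and "\<And>i. i < r \<Longrightarrow> \<alpha> i \<noteq> 1"
  shows "unified_M \<phi> r (n + m) z y k a b \<alpha> =
    (\<Sum>s=0..n. \<Sum>q=0..m. of_nat (n choose s) * of_nat (m choose q)
       * complex_of_real (z - x) ^ (s + q)
       * unified_M \<phi> r (n + m - s - q) x y k a b \<alpha>)"
  unfolding unified_M_shift [of \<phi> r "n + m" z y k a b \<alpha> x] sum_binomial_split
  by (simp add: atLeast0AtMost mult.assoc)

end
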